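(* Let $(X,\lambda)$ be a connected asymptotic resemblance space and $\mathcal{B}$ the bornology induced by $\lambda$. For any $A,B\subseteq X$, define $A\prec B$ if and only if $A$ and $X\setminus B$ are asymptotically disjoint. The relation $\prec$ induces a coarse proximity on the pair $(X,\mathcal{B})$ if and only if $(X,\lambda)$ is asymptotically normal.
   Context: An asymptotic resemblance on a set $X$ is an equivalence relation $\lambda$ on the power set of $X$ such that: (a) $A_1\lambda B_1$ and $A_2\lambda B_2$ imply $(A_1\cup A_2)\lambda(B_1\cup B_2)$; (b) $(B_1\cup B_2)\lambda A$ with $B_1,B_2\neq\emptyset$ implies that there are nonempty $A_1,A_2\subseteq A$ with $A=A_1\cup A_2$, $B_1\lambda A_1$, $B_2\lambda A_2$. The pair $(X,\lambda)$ is an asymptotic resemblance space. It is connected if $\{x\}\lambda\{y\}$ for all $x,y\in X$. A set $A\subseteq X$ is (asymptotically) bounded if $A=\emptyset$ or $A\lambda\{x\}$ for some $x\in X$, and unbounded otherwise. Subsets $A,C\subseteq X$ are asymptotically disjoint if for all unbounded $A'\subseteq A$ and unbounded $C'\subseteq C$, $A'\lambda C'$ does not hold. $(X,\lambda)$ is asymptotically normal if for all asymptotically disjoint $A_1,A_2\subseteq X$ there are $X_1,X_2\subseteq X$ with $X=X_1\cup X_2$, $A_1$ asymptotically disjoint from $X_1$, and $A_2$ asymptotically disjoint from $X_2$. A bornology on $X$ is a family $\mathcal{B}$ of subsets of $X$ containing all singletons and closed under subsets and finite (binary) unions. For a connected asymptotic resemblance space, the bounded sets form a bornology, called the bornology induced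 by $\lambda$. A coarse proximity on a set $X$ with bornology $\mathcal{B}$ is a relation $\mathbf{b}$ on the power set of $X$ such that for all $A,B,C\subseteq X$ (writing $\bar{\mathbf{b}}$ for the negation of $\mathbf{b}$): (i) $A\mathbf{b}B$ implies $B\mathbf{b}A$; (ii) $A\mathbf{b}B$ implies $A\notin\mathcal{B}$ and $B\notin\mathcal{B}$; (iii) $A\cap B\notin\mathcal{B}$ implies $A\mathbf{b}B$; (iv) $(A\cup B)\mathbf{b}C$ if and only if $A\mathbf{b}C$ or $B\mathbf{b}C$; (v) $A\bar{\mathbf{b}}B$ implies that there exists $E\subseteq X$ with $A\bar{\mathbf{b}}E$ and $(X\setminus E)\bar{\mathbf{b}}B$. A binary relation $\ll$ on the power set of $X$ induces a coarse proximity on the pair $(X,\mathcal{B})$ if it satisfies, for all subsets of $X$: (1) $X\ll (X\setminus D)$ for all $D\in\mathcal{B}$; (2) $A\ll B$ implies there exists $D\in\mathcal{B}$ with $A\setminus D\subseteq B$; (3) $A\subseteq B\ll C\subseteq D$ implies $A\ll D$; (4) $A\ll B_1$ and $A\ll B_2$ if and only if $A\ll (B_1\cap B_2)$; (5) $A\ll B$ if and only if $(X\setminus B)\ll (X\setminus A)$; (6) $A\ll B$ implies that there exists $C\subseteq X$ with $A\ll C\ll B$. The induced coarse proximity is then the relation $\mathbf{b}$ given by $A\bar{\mathbf{b}}B$ if and only if $A\ll (X\setminus B)$. *)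

theory Defs
  imports Main
begin

text \<open>
  All structures live on an explicit carrier set \<open>X\<close>, which may be empty. Relations on the power
  set of \<open>X\<close> are binary predicates on sets; their values outside \<open>Pow X\<close> are irrelevant, because
  every quantifier below is restricted to subsets of \<open>X\<close>.
\<close>

definition asymptotic_resemblance :: "'a set \<Rightarrow> ('a set \<Rightarrow> 'a set \<Rightarrow> bool) \<Rightarrow> bool" where
  "asymptotic_resemblance X lam \<longleftrightarrow>
     reflp_on (Pow X) lam \<and> symp_on (Pow X) lam \<and> transp_on (Pow X) lam \<and>
     (\<forall>A\<^sub>1\<subseteq>X. \<forall>A\<^sub>2\<subseteq>X. \<forall>B\<^sub>1\<subseteq>X. \<forall>B\<^sub>2\<subseteq>X.
        lam A\<^sub>1 B\<^sub>1 \<longrightarrow> lam A\<^sub>2 B\<^sub>2 \<longrightarrow> lam (A\<^sub>1 \<union> A\<^sub>2) (B\<^sub>1 \<union> B\<^sub>2)) \<and>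
     (\<forall>A\<subseteq>X. \<forall>B\<^sub>1\<subseteq>X. \<forall>B\<^sub>2\<subseteq>X.
        lam (B\<^sub>1 \<union> B\<^sub>2) A \<longrightarrow> B\<^sub>1 \<noteq> {} \<longrightarrow> B\<^sub>2 \<noteq> {} \<longrightarrow>
        (\<exists>A\<^sub>1 A\<^sub>2. A\<^sub>1 \<subseteq> A \<and> A\<^sub>2 \<subseteq> A \<and> A\<^sub>1 \<noteq> {} \<and> A\<^sub>2 \<noteq> {} \<and> A = A\<^sub>1 \<union> A\<^sub>2 \<and>
           lam B\<^sub>1 A\<^sub>1 \<and> lam B\<^sub>2 A\<^sub>2))"

definition asymp_connected :: "'a set \<Rightarrow> ('a set \<Rightarrow> 'a set \<Rightarrow> bool) \<Rightarrow> bool" where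
  "asymp_connected X lam \<longleftrightarrow> (\<forall>x\<in>X. \<forall>y\<in>X. lam {x} {y})"

definition asymp_bounded :: "'a set \<Rightarrow> ('a set \<Rightarrow> 'a set \<Rightarrow> bool) \<Rightarrow> 'a set \<Rightarrow> bool" where
  "asymp_bounded X lam A \<longleftrightarrow> A = {} \<or> (\<exists>x\<in>X. lam A {x})"

definition asymp_disjoint ::
    "'a set \<Rightarrow> ('a set \<Rightarrow> 'a set \<Rightarrow> bool) \<Rightarrow> 'a set \<Rightarrow> 'a set \<Rightarrow> bool" where
  "asymp_disjoint X lam A C \<longleftrightarrow>
     (\<forall>A'\<subseteq>A. \<forall>C'\<subseteq>C. \<not> asymp_bounded X lam A' \<longrightarrow> \<not> asymp_bounded X lam C' \<longrightarrow> \<not> lam A' C')"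

definition asymp_normal :: "'a set \<Rightarrow> ('a set \<Rightarrow> 'a set \<Rightarrow> bool) \<Rightarrow> bool" where
  "asymp_normal X lam \<longleftrightarrow>
     (\<forall>A\<^sub>1\<subseteq>X. \<forall>A\<^sub>2\<subseteq>X. asymp_disjoint X lam A\<^sub>1 A\<^sub>2 \<longrightarrow>
        (\<exists>X\<^sub>1 X\<^sub>2. X\<^sub>1 \<subseteq> X \<and> X\<^sub>2 \<subseteq> X \<and> X = X\<^sub>1 \<union> X\<^sub>2 \<and>
           asymp_disjoint X lam A\<^sub>1 X\<^sub>1 \<and> asymp_disjoint X lam A\<^sub>2 X\<^sub>2))"

definition asymp_prec ::
    "'a set \<Rightarrow> ('a set \<Rightarrow> 'a set \<Rightarrow> bool) \<Rightarrow> 'a set \<Rightarrow> 'a set \<Rightarrow> bool" where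
  "asymp_prec X lam A B \<longleftrightarrow> asymp_disjoint X lam A (X - B)"

definition bornology :: "'a set \<Rightarrow> 'a set set \<Rightarrow> bool" where
  "bornology X \<B> \<longleftrightarrow>
     \<B> \<subseteq> Pow X \<and> (\<forall>x\<in>X. {x} \<in> \<B>) \<and> (\<forall>B\<in>\<B>. \<forall>A\<subseteq>B. A \<in> \<B>) \<and> (\<forall>A\<in>\<B>. \<forall>B\<in>\<B>. A \<union> B \<in> \<B>)"

definition induced_bornology :: "'a set \<Rightarrow> ('a set \<Rightarrow> 'a set \<Rightarrow> bool) \<Rightarrow> 'a set set" where
  "induced_bornology X lam = {A. A \<subseteq> X \<and> asymp_bounded X lam A}"

definition coarse_proximity ::
    "'a set \<Rightarrow> 'a set set \<Rightarrow> ('a set \<Rightarrow> 'a set \<Rightarrow> bool) \<Rightarrow> bool" where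
  "coarse_proximity X \<B> b \<longleftrightarrow>
     bornology X \<B> \<and>
     (\<forall>A\<subseteq>X. \<forall>B\<subseteq>X. b A B \<longrightarrow> b B A) \<and>
     (\<forall>A\<subseteq>X. \<forall>B\<subseteq>X. b A B \<longrightarrow> A \<notin> \<B> \<and> B \<notin> \<B>) \<and>
     (\<forall>A\<subseteq>X. \<forall>B\<subseteq>X. A \<inter> B \<notin> \<B> \<longrightarrow> b A B) \<and>
     (\<forall>A\<subseteq>X. \<forall>B\<subseteq>X. \<forall>C\<subseteq>X. b (A \<union> B) C \<longleftrightarrow> b A C \<or> b B C) \<and>
     (\<forall>A\<subseteq>X. \<forall>B\<subseteq>X. \<not> b A B \<longrightarrow> (\<exists>E\<subseteq>X. \<not> b A E \<and> \<not> b (X - E) B))"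

definition induces_coarse_proximity ::
    "'a set \<Rightarrow> 'a set set \<Rightarrow> ('a set \<Rightarrow> 'a set \<Rightarrow> bool) \<Rightarrow> bool" where
  "induces_coarse_proximity X \<B> ll \<longleftrightarrow>
     bornology X \<B> \<and>
     (\<forall>D\<in>\<B>. ll X (X - D)) \<and>
     (\<forall>A\<subseteq>X. \<forall>B\<subseteq>X. ll A B \<longrightarrow> (\<exists>D\<in>\<B>. A - D \<subseteq> B)) \<and>
     (\<forall>A\<subseteq>X. \<forall>B\<subseteq>X. \<forall>C\<subseteq>X. \<forall>D\<subseteq>X. A \<subseteq> B \<longrightarrow> ll B C \<longrightarrow> C \<subseteq> D \<longrightarrow> ll A D) \<and>
     (\<forall>A\<subseteq>X. \<forall>B\<^sub>1\<subseteq>X. \<forall>B\<^sub>2\<subseteq>X. ll A B\<^sub>1 \<and> ll A B\<^sub>2 \<longleftrightarrow> ll A (B\<^sub>1 \<inter> B\<^sub>2)) \<and>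
     (\<forall>A\<subseteq>X. \<forall>B\<subseteq>X. ll A B \<longleftrightarrow> ll (X - B) (X - A)) \<and>
     (\<forall>A\<subseteq>X. \<forall>B\<subseteq>X. ll A B \<longrightarrow> (\<exists>C\<subseteq>X. ll A C \<and> ll C B))"

text \<open>
  The relation \<open>b\<close> determined by \<open>\<not> b A B \<longleftrightarrow> ll A (X - B)\<close> is indeed a coarse proximity, which
  justifies the name of the preceding notion.
\<close>

lemma coarse_proximity_if_induces:
  assumes "induces_coarse_proximity X \<B> ll"
  shows "coarse_proximity X \<B> (\<lambda>A B. \<not> ll A (X - B))"
proof -
  note d = assms[unfolded induces_coarse_proximity_def]
  note born = d[THEN conjunct1]
  have 1: "ll X (X - D)" if "D \<in> \<B>" for D
    using d[THEN conjunct2, THEN conjunct1] that by simp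
  have 2: "\<exists>D\<in>\<B>. A - D \<subseteq> B" if "A \<subseteq> X" "B \<subseteq> X" "ll A B" for A B
    using d[THEN conjunct2, THEN conjunct2, THEN conjunct1] that by simp
  have 3: "ll A D" if "D \<subseteq> X" "A \<subseteq> B" "B \<subseteq> X" "ll B C" "C \<subseteq> D" for A B C D
    using d[THEN conjunct2, THEN conjunct2, THEN conjunct2, THEN conjunct1, rule_format, of A B C D] that by blast
  have 4: "ll A B \<and> ll A C \<longleftrightarrow> ll A (B \<inter> C)" if "A \<subseteq> X" "B \<subseteq> X" "C \<subseteq> X" for A B C
    using d[THEN conjunct2, THEN conjunct2, THEN conjunct2, THEN conjunct2, THEN conjunct1] that by simp
  have 5: "ll A B \<longleftrightarrow> ll (X - B) (X - A)" if "A \<subseteq> X" "B \<subseteq> X" for A B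
    using d[THEN conjunct2, THEN conjunct2, THEN conjunct2, THEN conjunct2, THEN conjunct2, THEN conjunct1] that by blast
  have 6: "\<exists>C\<subseteq>X. ll A C \<and> ll C B" if "A \<subseteq> X" "B \<subseteq> X" "ll A B" for A B
    using d[THEN conjunct2, THEN conjunct2, THEN conjunct2, THEN conjunct2, THEN conjunct2, THEN conjunct2] that by simp
  have XX: "X - (X - A) = A" if "A \<subseteq> X" for A
    using that by blast
  have sym: "ll A (X - B) \<longleftrightarrow> ll B (X - A)" if "A \<subseteq> X" "B \<subseteq> X" for A B
    using 5[of A "X - B"] that by (simp add: XX)
  have small: "ll A (X - B)" if "A \<subseteq> X" "B \<in> \<B>" for A B
    using 3[of "X - B" A X "X - B"] 1[of B] that by blast
  have meet: "A \<inter> B \<in> \<B>" if p: "A \<subseteq> X" "B \<subseteq> X" "ll A (X - B)" for A B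
  proof -
    obtain D where D: "D \<in> \<B>" "A - D \<subseteq> X - B"
      using 2[of A "X - B"] p by blast
    then have "A \<inter> B \<subseteq> D" by blast
    then show ?thesis
      using born D unfolding bornology_def by blast
  qed
  have un: "ll (A \<union> B) (X - C) \<longleftrightarrow> ll A (X - C) \<and> ll B (X - C)"
    if "A \<subseteq> X" "B \<subseteq> X" "C \<subseteq> X" for A B C
  proof -
    have "ll (A \<union> B) (X - C) \<longleftrightarrow> ll C ((X - A) \<inter> (X - B))"
      using sym[of "A \<union> B" C] that by (simp add: Diff_Un)
    then show ?thesis
      using 4[of C "X - A" "X - B"] sym[of C A] sym[of C B] that by blast
  qed
  have mid: "\<exists>E\<subseteq>X. ll A (X - E) \<and> ll (X - E) (X - B)"
    if p: "A \<subseteq> X" "B \<subseteq> X" "ll A (X - B)" for A B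
  proof -
    obtain C where "C \<subseteq> X" "ll A C" "ll C (X - B)"
      using 6[of A "X - B"] p by blast
    then show ?thesis
      by (intro exI[of _ "X - C"]) (auto simp: XX)
  qed
  show ?thesis
    unfolding coarse_proximity_def
  proof (intro conjI allI impI)
    show "bornology X \<B>" by (rule born)
  next
    fix A B assume "A \<subseteq> X" "B \<subseteq> X" "\<not> ll A (X - B)"
    then show "\<not> ll B (X - A)" using sym[of A B] by blast
  next
    fix A B assume "A \<subseteq> X" "B \<subseteq> X" "\<not> ll A (X - B)"
    then show "A \<notin> \<B>" using sym[of A B] small[of B A] by blast
  next
    fix A B assume "A \<subseteq> X" "B \<subseteq> X" "\<not> ll A (X - B)"
    then show "B \<notin> \<B>" using small[of A B] by blast
  next
    fix A B assume "A \<subseteq> X" "B \<subseteq> X" "A \<inter> B \<notin> \<B>"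
    then show "\<not> ll A (X - B)" using meet[of A B] by blast
  next
    fix A B C assume "A \<subseteq> X" "B \<subseteq> X" "C \<subseteq> X"
    then show "(\<not> ll (A \<union> B) (X - C)) = (\<not> ll A (X - C) \<or> \<not> ll B (X - C))"
      using un[of A B C] by blast
  next
    fix A B assume "A \<subseteq> X" "B \<subseteq> X" "\<not> \<not> ll A (X - B)"
    then show "\<exists>E\<subseteq>X. \<not> \<not> ll A (X - E) \<and> \<not> \<not> ll (X - E) (X - B)"
      using mid[of A B] by simp
  qed
qed

lemma bornology_induced_bornology:
  assumes "asymptotic_resemblance X lam" "asymp_connected X lam"
  shows "bornology X (induced_bornology X lam)"
proof -
  note d = assms(1)[unfolded asymptotic_resemblance_def]
  have refl: "lam A A" if "A \<subseteq> X" for A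
    using d[THEN conjunct1] that by (simp add: reflp_on_def)
  have trans: "lam A C" if "A \<subseteq> X" "B \<subseteq> X" "C \<subseteq> X" "lam A B" "lam B C" for A B C
    using d[THEN conjunct2, THEN conjunct2, THEN conjunct1] that unfolding transp_on_def by blast
  have un: "lam (A \<union> C) (B \<union> D)"
    if "A \<subseteq> X" "B \<subseteq> X" "C \<subseteq> X" "D \<subseteq> X" "lam A B" "lam C D" for A B C D
    using d[THEN conjunct2, THEN conjunct2, THEN conjunct2, THEN conjunct1] that by simp
  have split: "\<exists>D\<subseteq>A. D \<noteq> {} \<and> lam B D"
    if "A \<subseteq> X" "B \<subseteq> X" "C \<subseteq> X" "lam (B \<union> C) A" "B \<noteq> {}" "C \<noteq> {}" for A B C
    using d[THEN conjunct2, THEN conjunct2, THEN conjunct2, THEN conjunct2, rule_format, of A B C] that by metis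
  have conn: "\<And>x y. x \<in> X \<Longrightarrow> y \<in> X \<Longrightarrow> lam {x} {y}"
    using assms(2) unfolding asymp_connected_def by blast
  have sub: "asymp_bounded X lam A" if p: "B \<subseteq> X" "asymp_bounded X lam B" "A \<subseteq> B" for A B
  proof (cases "A = {} \<or> A = B")
    case True
    then show ?thesis using p by (auto simp: asymp_bounded_def)
  next
    case False
    then have "B \<noteq> {}" using p by blast
    then obtain x where x: "x \<in> X" "lam B {x}"
      using p unfolding asymp_bounded_def by blast
    moreover have "A \<union> (B - A) = B" using p by blast
    ultimately obtain D where "D \<subseteq> {x}" "D \<noteq> {}" "lam A D"
      using split[of "{x}" A "B - A"] p False by auto
    then show ?thesis
      using x by (auto simp: asymp_bounded_def subset_singleton_iff)
  qed
  have join: "asymp_bounded X lam (A \<union> B)"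
    if p: "A \<subseteq> X" "B \<subseteq> X" "asymp_bounded X lam A" "asymp_bounded X lam B" for A B
  proof (cases "A = {} \<or> B = {}")
    case True
    then show ?thesis using p by auto
  next
    case False
    then obtain x y where xy: "x \<in> X" "lam A {x}" "y \<in> X" "lam B {y}"
      using p unfolding asymp_bounded_def by blast
    then have "lam B {x}"
      using trans[of B "{y}" "{x}"] conn p by simp
    then have "lam (A \<union> B) {x}"
      using un[of A "{x}" B "{x}"] xy p by simp
    then show ?thesis using xy by (auto simp: asymp_bounded_def)
  qed
  have "asymp_bounded X lam {x}" if "x \<in> X" for x
    using that refl[of "{x}"] by (auto simp: asymp_bounded_def)
  then show ?thesis
    unfolding bornology_def induced_bornology_def using sub join by auto
qed

end

theory Submission
  imports Defs
begin

text \<open>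
  Write \<open>A\<close> \<open>\<bottom>\<close> \<open>C\<close> for asymptotic disjointness, so that \<open>A \<prec> B\<close> means \<open>A\<close> \<open>\<bottom>\<close> \<open>X - B\<close>.
  Every axiom of a coarse proximity except interpolation holds for \<open>\<prec>\<close> in any connected asymptotic
  resemblance space: \<open>\<bottom>\<close> is symmetric, passes to subsets, holds as soon as one side is bounded,
  and forces \<open>A \<inter> C\<close> to be bounded by reflexivity of the resemblance. Compatibility with
  intersections amounts to additivity of \<open>\<bottom>\<close> (lemma \<open>asymp_disjoint_Un_right\<close>), which rests on
  the decomposition property of a resemblance.

  Interpolation, in turn, is a rewording of normality: a set \<open>C\<close> with \<open>A \<prec> C \<prec> B\<close> is the same as
  a cover \<open>X = (X - C) \<union> C\<close> with \<open>A\<close> \<open>\<bottom>\<close> \<open>X - C\<close> and \<open>X - B\<close> \<open>\<bottom>\<close> \<open>C\<close>; a cover by two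
  overlapping sets can be shrunk to one of this form.
\<close>

lemma asymp_bounded_resemblance:
  assumes "asymptotic_resemblance X lam" "A \<subseteq> X" "B \<subseteq> X"
    and "lam A B" "B \<noteq> {}" "asymp_bounded X lam B"
  shows "asymp_bounded X lam A"
proof -
  obtain x where x: "x \<in> X" "lam B {x}"
    using assms(5,6) unfolding asymp_bounded_def by blast
  have "transp_on (Pow X) lam"
    using assms(1) by (simp add: asymptotic_resemblance_def)
  then have "lam A {x}"
    by (rule transp_onD[of _ _ A B]) (use assms x in auto)
  then show ?thesis
    using x by (auto simp: asymp_bounded_def)
qed

lemma asymp_bounded_subset:
  assumes "asymptotic_resemblance X lam" "asymp_connected X lam"
    and "B \<subseteq> X" "asymp_bounded X lam B" "A \<subseteq> B"
  shows "asymp_bounded X lam A"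
  using bornology_induced_bornology[OF assms(1,2)] assms(3-5)
  unfolding bornology_def induced_bornology_def by blast

lemma asymp_bounded_Un:
  assumes "asymptotic_resemblance X lam" "asymp_connected X lam"
    and "A \<subseteq> X" "B \<subseteq> X" "asymp_bounded X lam A" "asymp_bounded X lam B"
  shows "asymp_bounded X lam (A \<union> B)"
  using bornology_induced_bornology[OF assms(1,2)] assms(3-6)
  unfolding bornology_def induced_bornology_def by blast

lemma asymp_disjoint_mono:
  assumes "asymp_disjoint X lam A C" "A' \<subseteq> A" "C' \<subseteq> C"
  shows "asymp_disjoint X lam A' C'"
  using assms unfolding asymp_disjoint_def by (meson subset_trans)

lemma asymp_disjoint_sym:
  assumes "asymptotic_resemblance X lam" "A \<subseteq> X" "C \<subseteq> X" "asymp_disjoint X lam A C"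
  shows "asymp_disjoint X lam C A"
  unfolding asymp_disjoint_def
proof (intro allI impI notI)
  fix C' A' assume *: "C' \<subseteq> C" "A' \<subseteq> A" "\<not> asymp_bounded X lam C'" "\<not> asymp_bounded X lam A'"
    "lam C' A'"
  have "symp_on (Pow X) lam"
    using assms(1) by (simp add: asymptotic_resemblance_def)
  then have "lam A' C'"
    by (rule symp_onD) (use assms(2,3) * in auto)
  then show False
    using * assms(4) unfolding asymp_disjoint_def by blast
qed

lemma asymp_disjoint_bounded_right:
  assumes "asymptotic_resemblance X lam" "asymp_connected X lam"
    and "C \<subseteq> X" "asymp_bounded X lam C"
  shows "asymp_disjoint X lam A C"
  using asymp_bounded_subset[OF assms] unfolding asymp_disjoint_def by blast

lemma asymp_bounded_Int_if_asymp_disjoint: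
  assumes "asymptotic_resemblance X lam" "A \<subseteq> X" "asymp_disjoint X lam A C"
  shows "asymp_bounded X lam (A \<inter> C)"
proof -
  have "reflp_on (Pow X) lam"
    using assms(1) by (simp add: asymptotic_resemblance_def)
  then have "lam (A \<inter> C) (A \<inter> C)"
    by (rule reflp_onD) (use assms(2) in auto)
  then show ?thesis
    using assms(3) unfolding asymp_disjoint_def by (meson Int_lower1 Int_lower2)
qed

text \<open>
  If an unbounded subset of \<open>C \<union> D\<close> resembles a subset \<open>A'\<close> of \<open>A\<close>, the decomposition property
  cuts \<open>A'\<close> into a part resembling the piece in \<open>C\<close> and a part resembling the piece in \<open>D\<close>. One of
  the two pieces is unbounded, hence so is the corresponding part of \<open>A'\<close>.
\<close>

lemma asymp_disjoint_Un_right: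
  assumes ar: "asymptotic_resemblance X lam" and conn: "asymp_connected X lam"
    and sub: "A \<subseteq> X" "C \<subseteq> X" "D \<subseteq> X"
    and disj: "asymp_disjoint X lam A C" "asymp_disjoint X lam A D"
  shows "asymp_disjoint X lam A (C \<union> D)"
  unfolding asymp_disjoint_def
proof (intro allI impI notI)
  fix A' E
  assume A': "A' \<subseteq> A" "\<not> asymp_bounded X lam A'"
    and E: "E \<subseteq> C \<union> D" "\<not> asymp_bounded X lam E" and rel: "lam A' E"
  let ?P = "E \<inter> C" and ?Q = "E - C"
  have subs: "A' \<subseteq> X" "?P \<subseteq> X" "?Q \<subseteq> X" "E \<subseteq> X"
    using A' E sub by auto
  have sym: "lam S T" if "S \<subseteq> X" "T \<subseteq> X" "lam T S" for S T
    using ar[unfolded asymptotic_resemblance_def, THEN conjunct2, THEN conjunct1] that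
    by (simp add: symp_on_def)
  show False
  proof (cases "?P = {} \<or> ?Q = {}")
    case True
    then have "E \<subseteq> C \<or> E \<subseteq> D" using E by blast
    then show False
      using disj A' E rel unfolding asymp_disjoint_def by blast
  next
    case False
    have split: "\<exists>A\<^sub>1 A\<^sub>2. A\<^sub>1 \<subseteq> S \<and> A\<^sub>2 \<subseteq> S \<and> A\<^sub>1 \<noteq> {} \<and> A\<^sub>2 \<noteq> {} \<and> lam P A\<^sub>1 \<and> lam Q A\<^sub>2"
      if "S \<subseteq> X" "P \<subseteq> X" "Q \<subseteq> X" "lam (P \<union> Q) S" "P \<noteq> {}" "Q \<noteq> {}" for S P Q
      using ar[unfolded asymptotic_resemblance_def, THEN conjunct2, THEN conjunct2,
          THEN conjunct2, THEN conjunct2, rule_format, of S P Q] that by metis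
    have "?P \<union> ?Q = E" by blast
    then have "lam (?P \<union> ?Q) A'"
      using sym[OF _ _ rel] subs by simp
    then obtain A\<^sub>1 A\<^sub>2 where parts: "A\<^sub>1 \<subseteq> A'" "A\<^sub>2 \<subseteq> A'" "A\<^sub>1 \<noteq> {}" "A\<^sub>2 \<noteq> {}"
        "lam ?P A\<^sub>1" "lam ?Q A\<^sub>2"
      using split[of A' ?P ?Q] subs False by blast
    have piece: "asymp_bounded X lam P"
      if "P \<subseteq> X" "P \<subseteq> F" "S \<subseteq> A'" "S \<noteq> {}" "lam P S" "asymp_disjoint X lam A F" for P F S
    proof (rule ccontr)
      assume unb: "\<not> asymp_bounded X lam P"
      have "S \<subseteq> X" using that(3) subs by blast
      then have "\<not> asymp_bounded X lam S" "lam S P"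
        using asymp_bounded_resemblance[OF ar that(1) _ that(5,4)] sym[OF _ that(1,5)] unb by auto
      moreover have "S \<subseteq> A" using that(3) A'(1) by blast
      ultimately show False
        using that(2,6) unb unfolding asymp_disjoint_def by blast
    qed
    have "asymp_bounded X lam ?P"
      by (rule piece[of ?P C A\<^sub>1]) (use subs parts disj in auto)
    moreover have "asymp_bounded X lam ?Q"
      by (rule piece[of ?Q D A\<^sub>2]) (use subs parts disj E in auto)
    ultimately have "asymp_bounded X lam (?P \<union> ?Q)"
      by (intro asymp_bounded_Un[OF ar conn] subs)
    then show False
      using E \<open>?P \<union> ?Q = E\<close> by simp
  qed
qed

lemma asymp_prec_interpolation_iff_asymp_normal:
  assumes ar: "asymptotic_resemblance X lam"
  shows "(\<forall>A\<subseteq>X. \<forall>B\<subseteq>X. asymp_prec X lam A B \<longrightarrow>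
            (\<exists>C\<subseteq>X. asymp_prec X lam A C \<and> asymp_prec X lam C B))
         \<longleftrightarrow> asymp_normal X lam" (is "?interpolation \<longleftrightarrow> _")
proof
  assume interpolation: ?interpolation
  show "asymp_normal X lam"
    unfolding asymp_normal_def
  proof (intro allI impI)
    fix A\<^sub>1 A\<^sub>2 assume *: "A\<^sub>1 \<subseteq> X" "A\<^sub>2 \<subseteq> X" "asymp_disjoint X lam A\<^sub>1 A\<^sub>2"
    then have compl: "X - (X - A\<^sub>2) = A\<^sub>2" by blast
    then have "asymp_prec X lam A\<^sub>1 (X - A\<^sub>2)"
      using * by (simp add: asymp_prec_def)
    then obtain C where C: "C \<subseteq> X" "asymp_disjoint X lam A\<^sub>1 (X - C)" "asymp_disjoint X lam C A\<^sub>2"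
      using interpolation[rule_format, of A\<^sub>1 "X - A\<^sub>2"] * unfolding asymp_prec_def compl by blast
    then have "asymp_disjoint X lam A\<^sub>2 C"
      using asymp_disjoint_sym[OF ar] * by blast
    then show "\<exists>X\<^sub>1 X\<^sub>2. X\<^sub>1 \<subseteq> X \<and> X\<^sub>2 \<subseteq> X \<and> X = X\<^sub>1 \<union> X\<^sub>2 \<and>
        asymp_disjoint X lam A\<^sub>1 X\<^sub>1 \<and> asymp_disjoint X lam A\<^sub>2 X\<^sub>2"
      using C by (intro exI[of _ "X - C"] exI[of _ C]) auto
  qed
next
  assume normal: "asymp_normal X lam"
  show ?interpolation
  proof (intro allI impI)
    fix A B assume *: "A \<subseteq> X" "B \<subseteq> X" "asymp_prec X lam A B"
    then obtain X\<^sub>1 X\<^sub>2 where cover: "X\<^sub>1 \<subseteq> X" "X\<^sub>2 \<subseteq> X" "X = X\<^sub>1 \<union> X\<^sub>2"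
        and disj: "asymp_disjoint X lam A X\<^sub>1" "asymp_disjoint X lam (X - B) X\<^sub>2"
      using normal[unfolded asymp_normal_def, rule_format, of A "X - B"]
      unfolding asymp_prec_def by blast
    have "X - X\<^sub>2 \<subseteq> X\<^sub>1" using cover by blast
    then have "asymp_prec X lam A X\<^sub>2"
      using asymp_disjoint_mono[OF disj(1) subset_refl] by (simp add: asymp_prec_def)
    moreover have "asymp_prec X lam X\<^sub>2 B"
      using asymp_disjoint_sym[OF ar _ _ disj(2)] cover(2) unfolding asymp_prec_def by blast
    ultimately show "\<exists>C\<subseteq>X. asymp_prec X lam A C \<and> asymp_prec X lam C B"
      using cover(2) by blast
  qed
qed

theorem corollary4p4:
  fixes X :: "'a set" and lam :: "'a set \<Rightarrow> 'a set \<Rightarrow> bool"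
  assumes "asymptotic_resemblance X lam"
    and "asymp_connected X lam"
  shows "induces_coarse_proximity X (induced_bornology X lam) (asymp_prec X lam)
           \<longleftrightarrow> asymp_normal X lam"
proof -
  note ar = assms(1)
  let ?B = "induced_bornology X lam" and ?ll = "asymp_prec X lam"
  have compl: "X - (X - A) = A" if "A \<subseteq> X" for A
    using that by blast
  have ax1: "\<forall>D\<in>?B. ?ll X (X - D)"
    using asymp_disjoint_bounded_right[OF assms]
    by (auto simp: asymp_prec_def induced_bornology_def compl)
  have ax2: "\<forall>A\<subseteq>X. \<forall>B\<subseteq>X. ?ll A B \<longrightarrow> (\<exists>D\<in>?B. A - D \<subseteq> B)"
  proof (intro allI impI)
    fix A B assume *: "A \<subseteq> X" "B \<subseteq> X" "?ll A B"
    then have "A \<inter> (X - B) \<in> ?B"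
      using asymp_bounded_Int_if_asymp_disjoint[OF ar, of A "X - B"]
      by (auto simp: asymp_prec_def induced_bornology_def)
    moreover have "A - A \<inter> (X - B) \<subseteq> B" using * by blast
    ultimately show "\<exists>D\<in>?B. A - D \<subseteq> B" by blast
  qed
  have ax3: "\<forall>A\<subseteq>X. \<forall>B\<subseteq>X. \<forall>C\<subseteq>X. \<forall>D\<subseteq>X. A \<subseteq> B \<longrightarrow> ?ll B C \<longrightarrow> C \<subseteq> D \<longrightarrow> ?ll A D"
    unfolding asymp_prec_def by (intro allI impI, erule asymp_disjoint_mono) auto
  have ax4: "\<forall>A\<subseteq>X. \<forall>B\<^sub>1\<subseteq>X. \<forall>B\<^sub>2\<subseteq>X. ?ll A B\<^sub>1 \<and> ?ll A B\<^sub>2 \<longleftrightarrow> ?ll A (B\<^sub>1 \<inter> B\<^sub>2)"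
  proof (intro allI impI iffI)
    fix A B\<^sub>1 B\<^sub>2 assume "A \<subseteq> X" "B\<^sub>1 \<subseteq> X" "B\<^sub>2 \<subseteq> X" "?ll A B\<^sub>1 \<and> ?ll A B\<^sub>2"
    then show "?ll A (B\<^sub>1 \<inter> B\<^sub>2)"
      using asymp_disjoint_Un_right[OF assms, of A "X - B\<^sub>1" "X - B\<^sub>2"]
      by (simp add: asymp_prec_def Diff_Int)
  next
    fix A B\<^sub>1 B\<^sub>2 assume "?ll A (B\<^sub>1 \<inter> B\<^sub>2)"
    then show "?ll A B\<^sub>1 \<and> ?ll A B\<^sub>2"
      unfolding asymp_prec_def
      by (intro conjI; elim asymp_disjoint_mono) auto
  qed
  have ax5: "\<forall>A\<subseteq>X. \<forall>B\<subseteq>X. ?ll A B \<longleftrightarrow> ?ll (X - B) (X - A)"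
    unfolding asymp_prec_def by (metis Diff_subset asymp_disjoint_sym[OF ar] compl)
  have "induces_coarse_proximity X ?B ?ll \<longleftrightarrow>
      (\<forall>A\<subseteq>X. \<forall>B\<subseteq>X. ?ll A B \<longrightarrow> (\<exists>C\<subseteq>X. ?ll A C \<and> ?ll C B))"
    unfolding induces_coarse_proximity_def
    \<comment> \<open>Each established axiom is replaced by \<open>True\<close> as a whole; used as a rewrite rule,
      the symmetry axiom \<open>ax5\<close> would loop.\<close>
    by (simp only: bornology_induced_bornology[OF assms] ax1[THEN eqTrueI] ax2[THEN eqTrueI]
        ax3[THEN eqTrueI] ax4[THEN eqTrueI] ax5[THEN eqTrueI] simp_thms)
  then show ?thesis
    using asymp_prec_interpolation_iff_asymp_normal[OF ar] by (rule trans)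
qed

end
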